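(* Let $M$ be the set $$M=\left\{ \sum_{i=1}^{n}H_{n_{i}}^{p_{i},q_{i}}\ \Big|\ n\in \mathbb{N}^{\ast },\ n_i\in\mathbb{N},\ p_{i},q_{i}\in \mathbb{Z}\text{ for all } i=1,\dots,n\right\} \cup \{0\}\subseteq S .$$ Then $M$ is a $\mathbb{Z}$-module (with the addition and the integer scalar multiplication of $S$).
   Context: Let $\omega$ be a primitive cube root of unity, $K=\mathbb{Q}(\omega)$, $a,b\in K^{*}$, and let $S=\left(\frac{a,b}{K,\omega}\right)$ be the symbol algebra of degree $3$: the associative unital $K$-algebra generated by $x,y$ with $x^3=a$, $y^3=b$, $yx=\omega xy$; it has $K$-basis $\{x^iy^j: 0\le i,j<3\}$. For integers $p,q$, the generalized Fibonacci numbers $h_n^{p,q}$ ($n\ge 0$) are defined by $h_0^{p,q}=p$, $h_1^{p,q}=q$, $h_n^{p,q}=h_{n-1}^{p,q}+h_{n-2}^{p,q}$ for $n\ge 2$. The $n$-th generalized Fibonacci symbol element is $$H_{n}^{p,q}=h_{n}^{p,q}\cdot 1+h_{n+1}^{p,q}x+h_{n+2}^{p,q}x^{2}+h_{n+3}^{p,q}y+h_{n+4}^{p,q}xy+h_{n+5}^{p,q}x^{2}y+h_{n+6}^{p,q}y^{2}+h_{n+7}^{p,q}xy^{2}+h_{n+8}^{p,q}x^{2}y^{2}\in S.$$ $\mathbb{N}$ includes $0$ and $\mathbb{N}^*=\mathbb{N}\setminus\{0\}$. *)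

theory Defs
  imports Complex_Main "HOL-Algebra.IntRing" "HOL-Algebra.Module"
    "HOL-Algebra.Generated_Fields" "HOL-Algebra.Algebraic_Closure_Type"
begin

definition primitive_cube_root :: "complex \<Rightarrow> bool" where
  "primitive_cube_root \<omega> \<longleftrightarrow> \<omega> ^ 3 = 1 \<and> (\<forall>k::nat. 0 < k \<and> k < 3 \<longrightarrow> \<omega> ^ k \<noteq> 1)"

text \<open>The subfield generated by \<open>\<omega>\<close>; being of characteristic zero it contains the rationals.\<close>

definition rat_adjoin :: "complex \<Rightarrow> complex ring" where
  "rat_adjoin \<omega> = (let C = (ring_of_type_algebra :: complex ring)
    in C \<lparr>carrier := generate_field C {\<omega>}\<rparr>)"

text \<open>
  A (not necessarily commutative) associative unital \<open>K\<close>-algebra \<open>S\<close> with elements \<open>x\<close>, \<open>y\<close>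
  subject to the symbol relations and having the monomials \<open>x^i y^j\<close> with \<open>i, j < 3\<close> as a
  \<open>K\<close>-basis. These data determine \<open>(S, x, y)\<close> up to unique isomorphism. The library locale
  \<open>algebra\<close> is not applicable since it requires the algebra to be commutative.
\<close>

locale symbol_algebra3 =
  K?: field K + S?: ring S + module K S
  for K :: "('k, 'n) ring_scheme" (structure) and \<omega> a b :: 'k
    and S :: "('k, 's, 'm) module_scheme" (structure) and x y :: 's +
  assumes smult_mult_left: "\<lbrakk>c \<in> carrier K; u \<in> carrier S; v \<in> carrier S\<rbrakk>
      \<Longrightarrow> (c \<odot>\<^bsub>S\<^esub> u) \<otimes>\<^bsub>S\<^esub> v = c \<odot>\<^bsub>S\<^esub> (u \<otimes>\<^bsub>S\<^esub> v)"
    and smult_mult_right: "\<lbrakk>c \<in> carrier K; u \<in> carrier S; v \<in> carrier S\<rbrakk>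
      \<Longrightarrow> u \<otimes>\<^bsub>S\<^esub> (c \<odot>\<^bsub>S\<^esub> v) = c \<odot>\<^bsub>S\<^esub> (u \<otimes>\<^bsub>S\<^esub> v)"
    and scalars_closed: "\<omega> \<in> carrier K" "a \<in> carrier K - {\<zero>\<^bsub>K\<^esub>}" "b \<in> carrier K - {\<zero>\<^bsub>K\<^esub>}"
    and generators_closed: "x \<in> carrier S" "y \<in> carrier S"
    and x_cubed: "x [^]\<^bsub>S\<^esub> (3::nat) = a \<odot>\<^bsub>S\<^esub> \<one>\<^bsub>S\<^esub>"
    and y_cubed: "y [^]\<^bsub>S\<^esub> (3::nat) = b \<odot>\<^bsub>S\<^esub> \<one>\<^bsub>S\<^esub>"
    and yx: "y \<otimes>\<^bsub>S\<^esub> x = \<omega> \<odot>\<^bsub>S\<^esub> (x \<otimes>\<^bsub>S\<^esub> y)"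
    and monomial_basis: "u \<in> carrier S \<Longrightarrow>
      \<exists>!c. c \<in> ({..<3::nat} \<times> {..<3::nat}) \<rightarrow>\<^sub>E carrier K \<and>
        u = (\<Oplus>\<^bsub>S\<^esub>i\<in>{..<3}. \<Oplus>\<^bsub>S\<^esub>j\<in>{..<3}. c (i, j) \<odot>\<^bsub>S\<^esub> (x [^]\<^bsub>S\<^esub> i \<otimes>\<^bsub>S\<^esub> y [^]\<^bsub>S\<^esub> j))"

fun gfib :: "int \<Rightarrow> int \<Rightarrow> nat \<Rightarrow> int" where
  "gfib p q 0 = p"
| "gfib p q (Suc 0) = q"
| "gfib p q (Suc (Suc n)) = gfib p q (Suc n) + gfib p q n"

definition fib_symbol_element ::
  "(complex, 's, 'm) module_scheme \<Rightarrow> 's \<Rightarrow> 's \<Rightarrow> int \<Rightarrow> int \<Rightarrow> nat \<Rightarrow> 's" where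
  "fib_symbol_element S x y p q n =
      of_int (gfib p q n) \<odot>\<^bsub>S\<^esub> \<one>\<^bsub>S\<^esub>
    \<oplus>\<^bsub>S\<^esub> of_int (gfib p q (n + 1)) \<odot>\<^bsub>S\<^esub> x
    \<oplus>\<^bsub>S\<^esub> of_int (gfib p q (n + 2)) \<odot>\<^bsub>S\<^esub> x [^]\<^bsub>S\<^esub> (2::nat)
    \<oplus>\<^bsub>S\<^esub> of_int (gfib p q (n + 3)) \<odot>\<^bsub>S\<^esub> y
    \<oplus>\<^bsub>S\<^esub> of_int (gfib p q (n + 4)) \<odot>\<^bsub>S\<^esub> (x \<otimes>\<^bsub>S\<^esub> y)
    \<oplus>\<^bsub>S\<^esub> of_int (gfib p q (n + 5)) \<odot>\<^bsub>S\<^esub> (x [^]\<^bsub>S\<^esub> (2::nat) \<otimes>\<^bsub>S\<^esub> y)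
    \<oplus>\<^bsub>S\<^esub> of_int (gfib p q (n + 6)) \<odot>\<^bsub>S\<^esub> y [^]\<^bsub>S\<^esub> (2::nat)
    \<oplus>\<^bsub>S\<^esub> of_int (gfib p q (n + 7)) \<odot>\<^bsub>S\<^esub> (x \<otimes>\<^bsub>S\<^esub> y [^]\<^bsub>S\<^esub> (2::nat))
    \<oplus>\<^bsub>S\<^esub> of_int (gfib p q (n + 8)) \<odot>\<^bsub>S\<^esub> (x [^]\<^bsub>S\<^esub> (2::nat) \<otimes>\<^bsub>S\<^esub> y [^]\<^bsub>S\<^esub> (2::nat))"

definition fib_symbol_sums :: "(complex, 's, 'm) module_scheme \<Rightarrow> 's \<Rightarrow> 's \<Rightarrow> 's set" where
  "fib_symbol_sums S x y =
    {(\<Oplus>\<^bsub>S\<^esub>i\<in>{1..n}. fib_symbol_element S x y (p i) (q i) (m i)) | (n::nat) m p q. 1 \<le> n}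
    \<union> {\<zero>\<^bsub>S\<^esub>}"

text \<open>
  The additive group of \<open>S\<close> with its integer scalar multiplication. The library's \<open>module\<close>
  records extend \<open>ring\<close> records, so the multiplication is carried along, but the locale
  \<open>module\<close> imposes nothing on it.
\<close>

definition int_module :: "('s, 'm) ring_scheme \<Rightarrow> (int, 's) module" where
  "int_module S = \<lparr>carrier = carrier S, monoid.mult = monoid.mult S, one = one S, zero = zero S, add = add S,
    module.smult = (\<lambda>k v. [k] \<cdot>\<^bsub>S\<^esub> v)\<rparr>"

end

theory Submission
  imports Defs
begin

text \<open>
  Shifting the index gives \<open>H_n^{p,q} = H_0^{h_n,h_{n+1}}\<close>, and \<open>H_0^{p,q}\<close> is additive in
  \<open>(p, q)\<close>. Hence the set of finite sums is the image of the homomorphism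
  \<open>(p, q) \<mapsto> H_0^{p,q}\<close> from \<open>\<int>\<^sup>2\<close> to \<open>S\<close>, an additive subgroup.
\<close>

text \<open>As functions of \<open>m\<close>, both sides obey the Fibonacci recurrence and agree at
  0 and 1.\<close>

lemma gfib_shift: "gfib p q (n + m) = gfib (gfib p q n) (gfib p q (Suc n)) m"
  by (induction m rule: induct_nat_012) auto

lemma gfib_add: "gfib (p + p') (q + q') n = gfib p q n + gfib p' q' n"
  by (induction n rule: induct_nat_012) auto

lemma fib_symbol_element_shift:
  "fib_symbol_element S x y p q n =
    fib_symbol_element S x y (gfib p q n) (gfib p q (Suc n)) 0"
  by (simp only: fib_symbol_element_def gfib_shift[symmetric] add_0 add_0_right)

lemma rat_adjoin_simps:
  "\<one>\<^bsub>rat_adjoin \<omega>\<^esub> = 1" "\<zero>\<^bsub>rat_adjoin \<omega>\<^esub> = 0" "u \<oplus>\<^bsub>rat_adjoin \<omega>\<^esub> v = u + v"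
  by (simp_all add: rat_adjoin_def ring_of_type_algebra_def)

text \<open>The module laws of \<open>S\<close> apply only to scalars in \<open>carrier K\<close>,
  so the integer coefficients must be placed there. They are reached from 0 by repeatedly adding 1
  or -1.\<close>

lemma of_int_in_rat_adjoin:
  assumes "ring (rat_adjoin \<omega>)"
  shows "of_int k \<in> carrier (rat_adjoin \<omega>)"
proof -
  interpret ring "rat_adjoin \<omega>" by fact
  \<comment> \<open>The inverse in the record is characterized only by its own addition and zero;
    since these are the complex ones, it is the complex -1.\<close>
  have "\<ominus>\<^bsub>rat_adjoin \<omega>\<^esub> \<one>\<^bsub>rat_adjoin \<omega>\<^esub> = - 1"
    using l_neg[OF one_closed] by (simp add: rat_adjoin_simps eq_neg_iff_add_eq_0)
  then have minus: "- 1 \<in> carrier (rat_adjoin \<omega>)"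
    using a_inv_closed[OF one_closed] by simp
  have add: "u + v \<in> carrier (rat_adjoin \<omega>)"
    if "u \<in> carrier (rat_adjoin \<omega>)" "v \<in> carrier (rat_adjoin \<omega>)" for u v
    using a_closed[OF that] by (simp add: rat_adjoin_simps)
  show ?thesis
  proof (induction k rule: int_induct[where k = 0])
    case base
    then show ?case using zero_closed by (simp add: rat_adjoin_simps)
  next
    case (step1 i)
    then show ?case using add[OF _ one_closed] by (simp add: rat_adjoin_simps)
  next
    case (step2 i)
    then show ?case using add[OF _ minus] by simp
  qed
qed

text \<open>Integer multiples are powers in the commutative group \<open>add_monoid R\<close>, so
  the module laws are the laws of exponents.\<close>

lemma (in ring) module_int_subgroup:
  assumes "subgroup H (add_monoid R)"
  shows "module \<Z> ((int_module R)\<lparr>carrier := H\<rparr>)"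
proof -
  interpret H: subgroup H "add_monoid R" by fact
  have H: "v \<in> carrier R" if "v \<in> H" for v
    using that H.subset by auto
  have pow: "[k] \<cdot> v \<in> H" if "v \<in> H" for k :: int and v
    using add.subgroup_int_pow_closed[OF assms that] by (simp add: add_pow_def)
  show ?thesis
  proof (rule moduleI)
    show "cring \<Z>" by (rule int_is_cring)
    show "abelian_group ((int_module R)\<lparr>carrier := H\<rparr>)"
    proof (rule abelian_groupI, goal_cases)
      \<comment> \<open>Existence of a left inverse: the witness is the inverse taken in the ambient
        group, which stays in \<open>H\<close>.\<close>
      case (6 v)
      then show ?case
        using H.m_inv_closed[OF 6[simplified]] H l_neg
        by (auto simp: int_module_def a_inv_def intro!: bexI[of _ "inv\<^bsub>add_monoid R\<^esub> v"])
    qed (use H.m_closed H.one_closed in \<open>auto simp: int_module_def H a_ac\<close>)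
  qed (auto simp: int_module_def pow H add.int_pow_mult add.int_pow_distrib add.int_pow_pow
      mult.commute)
qed

locale rat_symbol_algebra3 =
  symbol_algebra3 "rat_adjoin \<omega>" \<omega> a b S x y
  for \<omega> a b and S :: "(complex, 's, 'm) module_scheme" (structure) and x y
begin

abbreviation fse :: "int \<Rightarrow> int \<Rightarrow> nat \<Rightarrow> 's" where
  "fse \<equiv> fib_symbol_element S x y"

lemma of_int_closed: "of_int k \<in> carrier (rat_adjoin \<omega>)"
  using of_int_in_rat_adjoin K.ring_axioms by blast

lemma fse_closed: "fse p q n \<in> carrier S"
  using generators_closed by (simp add: fib_symbol_element_def of_int_closed del: gfib.simps)

lemma of_int_add_smult:
  "v \<in> carrier S \<Longrightarrow> of_int (k + l) \<odot>\<^bsub>S\<^esub> v = of_int k \<odot>\<^bsub>S\<^esub> v \<oplus>\<^bsub>S\<^esub> of_int l \<odot>\<^bsub>S\<^esub> v"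
  using smult_l_distr[OF of_int_closed of_int_closed] by (simp add: rat_adjoin_simps)

text \<open>Additivity holds coefficient by coefficient. Sums inside \<open>of_int\<close> and the
  recurrence are kept folded so that \<open>of_int_add_smult\<close> can match.\<close>

lemma fse_add: "fse (p + p') (q + q') n = fse p q n \<oplus>\<^bsub>S\<^esub> fse p' q' n"
  using generators_closed
  by (simp add: fib_symbol_element_def gfib_add of_int_add_smult of_int_closed S.a_ac
      del: of_int_add gfib.simps add_2_eq_Suc')

lemma fse_0: "fse 0 0 n = \<zero>\<^bsub>S\<^esub>"
  \<comment> \<open>The element equals its own double, hence cancels to zero.\<close>
  using fse_add[of 0 0 0 0 n] fse_closed[of 0 0 n] S.add.l_cancel_one by auto

lemma fse_minus: "\<ominus>\<^bsub>S\<^esub> fse p q n = fse (- p) (- q) n"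
  using fse_add[of "- p" p "- q" q n] by (intro S.minus_equality) (simp_all add: fse_closed fse_0)

text \<open>All summands share the index \<open>n\<close>; sums with varying indices must first be
  shifted to a common one.\<close>

lemma fse_finsum:
  "finite I \<Longrightarrow> (\<Oplus>\<^bsub>S\<^esub>i\<in>I. fse (p i) (q i) n) = fse (\<Sum>i\<in>I. p i) (\<Sum>i\<in>I. q i) n"
  by (induction I rule: finite_induct) (simp_all add: fse_0 fse_add fse_closed)

lemma fib_symbol_sums_eq: "fib_symbol_sums S x y = {fse p q 0 | p q. True}" (is "_ = ?R")
proof
  have sums: "(\<Oplus>\<^bsub>S\<^esub>i\<in>{1..n}. fse (p i) (q i) (m i)) \<in> ?R" for n p q and m :: "nat \<Rightarrow> nat"
  proof -
    \<comment> \<open>The varying index \<open>m i\<close> is absorbed into the two initial values,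
      bringing every summand to index 0.\<close>
    have "fse (p i) (q i) (m i) = fse (gfib (p i) (q i) (m i)) (gfib (p i) (q i) (Suc (m i))) 0" for i
      by (rule fib_symbol_element_shift)
    then have "(\<Oplus>\<^bsub>S\<^esub>i\<in>{1..n}. fse (p i) (q i) (m i))
        = (\<Oplus>\<^bsub>S\<^esub>i\<in>{1..n}. fse (gfib (p i) (q i) (m i)) (gfib (p i) (q i) (Suc (m i))) 0)"
      by (rule arg_cong[OF ext])
    also have "\<dots> = fse (\<Sum>i\<in>{1..n}. gfib (p i) (q i) (m i)) (\<Sum>i\<in>{1..n}. gfib (p i) (q i) (Suc (m i))) 0"
      by (rule fse_finsum) simp
    also have "\<dots> \<in> ?R"
      by blast
    finally show ?thesis .
  qed
  show "fib_symbol_sums S x y \<subseteq> ?R"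
  proof
    fix u assume "u \<in> fib_symbol_sums S x y"
    then consider n m p q where "u = (\<Oplus>\<^bsub>S\<^esub>i\<in>{1..n::nat}. fse (p i) (q i) (m i))" | "u = \<zero>\<^bsub>S\<^esub>"
      unfolding fib_symbol_sums_def by blast
    then show "u \<in> ?R"
    proof cases
      case 1
      show ?thesis unfolding 1 by (rule sums)
    next
      case 2
      then have "u = fse 0 0 0" by (simp only: fse_0)
      then show ?thesis by blast
    qed
  qed
  have "fse p q 0 \<in> fib_symbol_sums S x y" for p q
  proof -
    \<comment> \<open>A sum of length 1; the constant functions give it the shape required by the
      definition of \<open>fib_symbol_sums\<close>.\<close>
    have "fse p q 0 = (\<Oplus>\<^bsub>S\<^esub>i\<in>{1..1::nat}. fse ((\<lambda>_. p) i) ((\<lambda>_. q) i) ((\<lambda>_. 0) i))"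
      by (simp add: fse_closed)
    then show ?thesis
      unfolding fib_symbol_sums_def by fast
  qed
  then show "?R \<subseteq> fib_symbol_sums S x y"
    by blast
qed

lemma subgroup_fib_symbol_sums: "subgroup (fib_symbol_sums S x y) (add_monoid S)"
proof (rule S.add.subgroupI)
  show "fib_symbol_sums S x y \<subseteq> carrier S" "fib_symbol_sums S x y \<noteq> {}"
    by (auto simp: fib_symbol_sums_eq fse_closed)
  show "\<ominus>\<^bsub>S\<^esub> u \<in> fib_symbol_sums S x y" if "u \<in> fib_symbol_sums S x y" for u
    using that fse_minus unfolding fib_symbol_sums_eq by blast
  show "u \<oplus>\<^bsub>S\<^esub> v \<in> fib_symbol_sums S x y"
    if "u \<in> fib_symbol_sums S x y" "v \<in> fib_symbol_sums S x y" for u v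
    using that fse_add[symmetric] unfolding fib_symbol_sums_eq by blast
qed

end

theorem proposition4p4:
  fixes \<omega> a b :: complex
    and S :: "(complex, 's) module"
    and x y :: 's
  assumes "primitive_cube_root \<omega>"
    and "symbol_algebra3 (rat_adjoin \<omega>) \<omega> a b S x y"
  shows "fib_symbol_sums S x y \<subseteq> carrier S \<and>
    module \<Z> ((int_module S) \<lparr>carrier := fib_symbol_sums S x y\<rparr>)"
proof -
  interpret rat_symbol_algebra3 \<omega> a b S x y
    using assms(2) by (rule rat_symbol_algebra3.intro)
  show ?thesis
    using subgroup.subset[OF subgroup_fib_symbol_sums]
      S.module_int_subgroup[OF subgroup_fib_symbol_sums]
    by simp
qed

end
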